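(* Let $\mathcal{F}>0$ and let $\tilde Q:\mathbb{R}^3\rightrightarrows\mathbb{R}^3$ be the Coulomb friction mapping defined in the context, with the subsets $L,M_1,M_3^+$ of $\mathrm{gph}\,\tilde Q$ defined there. Then $\tilde Q$ is an SCD mapping and $\mathcal{O}_{\tilde Q}=L\cup M_1\cup M_3^+$. In particular, for $(\bar v,\bar g,\bar\vartheta)\in L$ $$\widehat{\mathcal{S}}\tilde Q(\bar v,\bar g,\bar\vartheta)=\mathcal{S}\tilde Q(\bar v,\bar g,\bar\vartheta)=\widehat{\mathcal{S}}^*\tilde Q(\bar v,\bar g,\bar\vartheta)=\mathcal{S}^*\tilde Q(\bar v,\bar g,\bar\vartheta)=\{\mathrm{rge}(I_3,0)\},$$ for $(\bar v,\bar g,\bar\vartheta)\in M_3^+$ $$\widehat{\mathcal{S}}\tilde Q(\bar v,\bar g,\bar\vartheta)=\mathcal{S}\tilde Q(\bar v,\bar g,\bar\vartheta)=\widehat{\mathcal{S}}^*\tilde Q(\bar v,\bar g,\bar\vartheta)=\mathcal{S}^*\tilde Q(\bar v,\bar g,\bar\vartheta)=\{\mathrm{rge}(0,I_3)\},$$ and for $(\bar v,\bar g,\bar\vartheta)\in M_1$ one has $$\widehat{\mathcal{S}}\tilde Q(\bar v,\bar g,\bar\vartheta)=\mathcal{S}\tilde Q(\bar v,\bar g,\bar\vartheta)=\left\{\mathrm{rge}\left[\begin{pmatrix}I_2&0\\0&0\end{pmatrix},\begin{pmatrix}-\mathcal{F}\bar\vartheta\frac1{\|\bar v_{12}\|}\left(I_2-\frac{\bar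 v_{12}\bar v_{12}^T}{\|\bar v_{12}\|^2}\right)&-\mathcal{F}\frac{\bar v_{12}}{\|\bar v_{12}\|}\\0&1\end{pmatrix}\right]\right\},$$ $$\widehat{\mathcal{S}}^*\tilde Q(\bar v,\bar g,\bar\vartheta)=\mathcal{S}^*\tilde Q(\bar v,\bar g,\bar\vartheta)=\left\{\mathrm{rge}\left[\begin{pmatrix}I_2&0\\\mathcal{F}\frac{\bar v_{12}^T}{\|\bar v_{12}\|}&0\end{pmatrix},\begin{pmatrix}-\mathcal{F}\bar\vartheta\frac1{\|\bar v_{12}\|}\left(I_2-\frac{\bar v_{12}\bar v_{12}^T}{\|\bar v_{12}\|^2}\right)&0\\0&1\end{pmatrix}\right]\right\}.$$
   Context: For $v=(v_1,v_2,v_3)\in\mathbb{R}^3$ write $v_{12}=(v_1,v_2)$. The mapping $\tilde Q$ is given by $$\mathrm{gph}\,\tilde Q=\{(v,g,\vartheta)\in\mathbb{R}^3\times\mathbb{R}^2\times\mathbb{R}: \vartheta\in N_{\mathbb{R}_+}(v_3),\ g\in-\mathcal{F}\vartheta\,\partial\|v_{12}\|\},$$ i.e. $(g,\vartheta)\in\tilde Q(v)$ iff these conditions hold, where $\partial\|\cdot\|$ is the convex subdifferential of the Euclidean norm on $\mathbb{R}^2$ and $N_{\mathbb{R}_+}$ is the normal cone mapping of $\mathbb{R}_+=[0,\infty)$ (empty at negative arguments). Subsets of $\mathrm{gph}\,\tilde Q$: $L$: points with $v_3>0$, $\vartheta=0$; $M_1$: points with $v_3=0$, $\vartheta<0$,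 $v_{12}\ne0$; $M_3^+$: points with $v_3=0$, $\vartheta<0$, $v_{12}=0$, $\|g\|<-\mathcal{F}\vartheta$. SCD notions, for $F:\mathbb{R}^n\rightrightarrows\mathbb{R}^n$ with graph $\mathrm{gph}\,F=\{(x,y):y\in F(x)\}$. For a set $A$ and $\bar a\in A$, the tangent (contingent) cone $T_A(\bar a)$ is the set of all $u$ for which there are $t_k\downarrow0$, $u_k\to u$ with $\bar a+t_ku_k\in A$. $\mathcal{Z}_n$ is the metric space of $n$-dimensional subspaces of $\mathbb{R}^{2n}$ with $d_{\mathcal{Z}_n}(L_1,L_2)=\|P_{L_1}-P_{L_2}\|$ ($P_L$ the orthogonal projection onto $L$). For $L\in\mathcal{Z}_n$, $L^*:=\{(-v^*,u^* ):(u^*,v^* )\in L^\perp\}$. For $n\times n$ matrices $A,B$, $\mathrm{rge}(A,B)=\{(Au,Bu):u\in\mathbb{R}^n\}$. $\mathcal{O}_F$ is the set of $(x,y)\in\mathrm{gph}\,F$ with $T_{\mathrm{gph}\,F}(x,y)\in\mathcal{Z}_n$. $\widehat{\mathcal{S}}F(x,y)=\{T_{\mathrm{gph}\,F}(x,y)\}$ and $\widehat{\mathcal{S}}^*F(x,y)=\{T_{\mathrm{gph}\,F}(x,y)^*\}$ if $(x,y)\in\mathcal{O}_F$, both being $\emptyset$ otherwise. $\mathcal{S}F(x,y)$ (resp. $\mathcal{S}^*F(x,y)$) is the set of all limits in $\mathcal{Z}_n$ of sequences $T_{\mathrm{gph}\,F}(x_k,y_k)$ (resp. $T_{\mathrm{gph}\,F}(x_k,y_k)^*$)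 with $(x_k,y_k)\in\mathcal{O}_F$, $(x_k,y_k)\to(x,y)$. $F$ is an SCD mapping if $\mathcal{S}^*F(x,y)\neq\emptyset$ for every $(x,y)\in\mathrm{gph}\,F$. *)

theory Defs
  imports "HOL-Analysis.Analysis"
begin

section \<open>Subspace containing derivatives (SCD)\<close>

definition gph :: "(real^'n \<Rightarrow> (real^'n) set) \<Rightarrow> ((real^'n) \<times> (real^'n)) set" where
  "gph F = {(x, y). y \<in> F x}"

text \<open>In the convention \<open>t\<^sub>k \<down> 0\<close> the step sizes are positive and tend to zero; they are not
  required to be monotone.\<close>

definition tangent_cone :: "'a::real_normed_vector set \<Rightarrow> 'a \<Rightarrow> 'a set" where
  "tangent_cone A a = {u. \<exists>(t :: nat \<Rightarrow> real) (w :: nat \<Rightarrow> 'a).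
      (\<forall>k. 0 < t k) \<and> t \<longlonglongrightarrow> 0 \<and> w \<longlonglongrightarrow> u \<and> (\<forall>k. a + t k *\<^sub>R w k \<in> A)}"

definition Zn :: "((real^'n) \<times> (real^'n)) set set" where
  "Zn = {L. subspace L \<and> dim L = CARD('n)}"

definition orth_proj :: "'a::euclidean_space set \<Rightarrow> 'a \<Rightarrow> 'a" where
  "orth_proj L x = (THE p. p \<in> L \<and> x - p \<in> orthogonal_comp L)"

lemma orth_proj_unique:
  fixes L :: "'a::euclidean_space set"
  assumes "subspace L"
  shows "\<exists>!p. p \<in> L \<and> x - p \<in> orthogonal_comp L"
proof -
  obtain p q where p: "p \<in> span L" and q: "\<And>w. w \<in> span L \<Longrightarrow> orthogonal q w" and x: "x = p + q"
    using orthogonal_subspace_decomp_exists by blast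
  have sp: "span L = L" using assms by (simp add: span_eq_iff)
  show ?thesis
  proof (rule ex1I[of _ p])
    show "p \<in> L \<and> x - p \<in> orthogonal_comp L"
      using p q x sp by (auto simp: orthogonal_comp_def orthogonal_commute)
  next
    fix p' assume p': "p' \<in> L \<and> x - p' \<in> orthogonal_comp L"
    have d: "p' - p \<in> L" using p p' sp assms by (simp add: subspace_diff)
    have "(p' - p) \<bullet> q = 0" using q[of "p' - p"] d sp by (simp add: orthogonal_def inner_commute)
    moreover have "(p' - p) \<bullet> (x - p') = 0" using p' d by (auto simp: orthogonal_comp_def orthogonal_def)
    ultimately have "(p' - p) \<bullet> (p' - p) = 0" using x by (simp add: algebra_simps inner_diff_right inner_add_right)
    then show "p' = p" by simp
  qed
qed

text \<open>The norm of the difference of the projections is the operator norm.\<close>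

definition dist_Zn :: "((real^'n) \<times> (real^'n)) set \<Rightarrow> ((real^'n) \<times> (real^'n)) set \<Rightarrow> real" where
  "dist_Zn L1 L2 = onorm (\<lambda>x. orth_proj L1 x - orth_proj L2 x)"

definition adj_subspace :: "((real^'n) \<times> (real^'n)) set \<Rightarrow> ((real^'n) \<times> (real^'n)) set" where
  "adj_subspace L = {(- v, u) | u v. (u, v) \<in> orthogonal_comp L}"

definition rge :: "real^'n^'n \<Rightarrow> real^'n^'n \<Rightarrow> ((real^'n) \<times> (real^'n)) set" where
  "rge A B = {(A *v u, B *v u) | u. u \<in> UNIV}"

definition smooth_pts :: "(real^'n \<Rightarrow> (real^'n) set) \<Rightarrow> ((real^'n) \<times> (real^'n)) set" where
  "smooth_pts F = {z \<in> gph F. tangent_cone (gph F) z \<in> Zn}"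

definition S_hat :: "(real^'n \<Rightarrow> (real^'n) set) \<Rightarrow> (real^'n) \<times> (real^'n) \<Rightarrow> ((real^'n) \<times> (real^'n)) set set" where
  "S_hat F z = (if z \<in> smooth_pts F then {tangent_cone (gph F) z} else {})"

definition S_hat_adj :: "(real^'n \<Rightarrow> (real^'n) set) \<Rightarrow> (real^'n) \<times> (real^'n) \<Rightarrow> ((real^'n) \<times> (real^'n)) set set" where
  "S_hat_adj F z = (if z \<in> smooth_pts F then {adj_subspace (tangent_cone (gph F) z)} else {})"

definition S_lim :: "(real^'n \<Rightarrow> (real^'n) set) \<Rightarrow> (real^'n) \<times> (real^'n) \<Rightarrow> ((real^'n) \<times> (real^'n)) set set" where
  "S_lim F z = {L \<in> Zn. \<exists>\<zeta> :: nat \<Rightarrow> (real^'n) \<times> (real^'n).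
      (\<forall>k. \<zeta> k \<in> smooth_pts F) \<and> \<zeta> \<longlonglongrightarrow> z \<and>
      (\<lambda>k. dist_Zn (tangent_cone (gph F) (\<zeta> k)) L) \<longlonglongrightarrow> 0}"

definition S_lim_adj :: "(real^'n \<Rightarrow> (real^'n) set) \<Rightarrow> (real^'n) \<times> (real^'n) \<Rightarrow> ((real^'n) \<times> (real^'n)) set set" where
  "S_lim_adj F z = {L \<in> Zn. \<exists>\<zeta> :: nat \<Rightarrow> (real^'n) \<times> (real^'n).
      (\<forall>k. \<zeta> k \<in> smooth_pts F) \<and> \<zeta> \<longlonglongrightarrow> z \<and>
      (\<lambda>k. dist_Zn (adj_subspace (tangent_cone (gph F) (\<zeta> k))) L) \<longlonglongrightarrow> 0}"

definition SCD_mapping :: "(real^'n \<Rightarrow> (real^'n) set) \<Rightarrow> bool" where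
  "SCD_mapping F \<longleftrightarrow> (\<forall>z \<in> gph F. S_lim_adj F z \<noteq> {})"


section \<open>The Coulomb friction mapping\<close>

definition convex_subdifferential :: "('a::real_inner \<Rightarrow> real) \<Rightarrow> 'a \<Rightarrow> 'a set" where
  "convex_subdifferential f x = {s. \<forall>z. f z \<ge> f x + s \<bullet> (z - x)}"

definition normal_cone :: "'a::real_inner set \<Rightarrow> 'a \<Rightarrow> 'a set" where
  "normal_cone C x = (if x \<in> C then {s. \<forall>z\<in>C. s \<bullet> (z - x) \<le> 0} else {})"

definition v12 :: "real^3 \<Rightarrow> real^2" where
  "v12 v = vector [v$1, v$2]"

text \<open>The identification of \<open>\<real>\<^sup>2 \<times> \<real>\<close> with \<open>\<real>\<^sup>3\<close>, so that the friction mapping acts from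
  \<open>\<real>\<^sup>3\<close> to \<open>\<real>\<^sup>3\<close>.\<close>

definition vec21 :: "real^2 \<Rightarrow> real \<Rightarrow> real^3" where
  "vec21 g \<theta> = vector [g$1, g$2, \<theta>]"

definition Qt :: "real \<Rightarrow> real^3 \<Rightarrow> (real^3) set" where
  "Qt \<F> v = {vec21 g \<theta> | g \<theta>. \<theta> \<in> normal_cone {0..} (v$3) \<and>
      g \<in> (\<lambda>s. (- \<F> * \<theta>) *\<^sub>R s) ` convex_subdifferential norm (v12 v)}"

definition set_L :: "real \<Rightarrow> ((real^3) \<times> (real^3)) set" where
  "set_L \<F> = {(v, vec21 g \<theta>) | v g \<theta>. (v, vec21 g \<theta>) \<in> gph (Qt \<F>) \<and> v$3 > 0 \<and> \<theta> = 0}"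

definition set_M1 :: "real \<Rightarrow> ((real^3) \<times> (real^3)) set" where
  "set_M1 \<F> = {(v, vec21 g \<theta>) | v g \<theta>. (v, vec21 g \<theta>) \<in> gph (Qt \<F>) \<and>
      v$3 = 0 \<and> \<theta> < 0 \<and> v12 v \<noteq> 0}"

definition set_M3p :: "real \<Rightarrow> ((real^3) \<times> (real^3)) set" where
  "set_M3p \<F> = {(v, vec21 g \<theta>) | v g \<theta>. (v, vec21 g \<theta>) \<in> gph (Qt \<F>) \<and>
      v$3 = 0 \<and> \<theta> < 0 \<and> v12 v = 0 \<and> norm g < - \<F> * \<theta>}"

text \<open>\<open>block A b c d\<close> is the \<open>3 \<times> 3\<close> matrix with rows \<open>(A, b)\<close> and \<open>(c\<^sup>T, d)\<close>, where
  \<open>b\<close> is a column.\<close>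

definition block :: "real^2^2 \<Rightarrow> real^2 \<Rightarrow> real^2 \<Rightarrow> real \<Rightarrow> real^3^3" where
  "block A b c d = vector [vector [A$1$1, A$1$2, b$1],
                           vector [A$2$1, A$2$2, b$2],
                           vector [c$1, c$2, d]]"

definition outer :: "real^2 \<Rightarrow> real^2^2" where
  "outer w = (columnvector w :: real^1^2) ** (rowvector w :: real^2^1)"

end

theory Submission
  imports Defs
begin

text \<open>The graph of the friction mapping is given by the complementarity condition
  \<open>0 \<le> v\<^sub>3 \<bottom> \<theta> \<le> 0\<close> together with \<open>\<parallel>g\<parallel> \<le> - \<F> \<theta>\<close> and
  \<open>g \<bullet> v\<^sub>1\<^sub>2 = - \<F> \<theta> \<parallel>v\<^sub>1\<^sub>2\<parallel>\<close>. Near points of \<open>L\<close> and \<open>M\<^sub>3\<^sup>+\<close> it is therefore an affine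
  subspace, and near points of \<open>M\<^sub>1\<close> it is the smooth manifold \<open>v\<^sub>3 = 0\<close>,
  \<open>g = - \<F> \<theta> v\<^sub>1\<^sub>2 / \<parallel>v\<^sub>1\<^sub>2\<parallel>\<close>. At the remaining points, where either \<open>v\<^sub>3 = \<theta> = 0\<close> or \<open>v = 0\<close> and
  \<open>\<parallel>g\<parallel> = - \<F> \<theta> > 0\<close>, the tangent cone contains \<open>(e\<^sub>3, 0)\<close>, respectively \<open>((g, 0), 0)\<close>, but not the
  opposite direction. These points are limits of points in \<open>L\<close>, respectively in \<open>M\<^sub>3\<^sup>+\<close>, along which
  the tangent space is constant.\<close>

section \<open>Tangent cones\<close>

text \<open>The difference quotients of the curve along step sizes tending to zero from above serve
  as the directions \<open>w k\<close>. Being one-sided, the cone asks for membership in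
  \<open>A\<close> at small positive parameters.\<close>

lemma tangent_coneI_curve:
  fixes c :: "real \<Rightarrow> 'a::real_normed_vector"
  assumes der: "(c has_vector_derivative u) (at 0)"
    and mem: "\<forall>\<^sub>F t in at_right 0. c t \<in> A"
    and a: "c 0 = a"
  shows "u \<in> tangent_cone A a"
proof -
  obtain b where b: "0 < b" "\<And>t. 0 < t \<Longrightarrow> t < b \<Longrightarrow> c t \<in> A"
    using mem by (auto simp: eventually_at_right_field)
  \<comment> \<open>\<open>tangent_cone\<close> demands membership for every \<open>k\<close>, not
    just eventually, so the whole sequence is placed in the interval (0, b).\<close>
  define t where "t = (\<lambda>k. b / 2 * inverse (real (Suc k)))"
  have t: "0 < t k" "t k < b" for k
    using b(1) by (auto simp: t_def field_simps intro: add_pos_nonneg)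
  have t0: "t \<longlonglongrightarrow> 0"
    using tendsto_mult[OF tendsto_const LIMSEQ_inverse_real_of_nat, of "b / 2"]
    by (simp only: t_def mult_zero_right)
  have "((\<lambda>h. norm ((1 / h) *\<^sub>R (c h - c 0) - u)) \<longlongrightarrow> 0) (at 0)"
  proof (rule Lim_transform_eventually)
    show "((\<lambda>h. norm (c (0 + h) - c 0 - h *\<^sub>R u) / norm h) \<longlongrightarrow> 0) (at 0)"
      using der by (simp add: has_vector_derivative_def has_derivative_at)
    show "\<forall>\<^sub>F h in at 0. norm (c (0 + h) - c 0 - h *\<^sub>R u) / norm h = norm ((1 / h) *\<^sub>R (c h - c 0) - u)"
      unfolding eventually_at_filter
    proof (intro always_eventually allI impI)
      fix h :: real assume "h \<noteq> 0"
      then have "(1 / h) *\<^sub>R (c h - c 0) - u = (1 / h) *\<^sub>R (c h - c 0 - h *\<^sub>R u)"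
        by (simp add: scaleR_diff_right)
      then show "norm (c (0 + h) - c 0 - h *\<^sub>R u) / norm h = norm ((1 / h) *\<^sub>R (c h - c 0) - u)"
        by (simp only: norm_scaleR) simp
    qed
  qed
  then have "((\<lambda>h. (1 / h) *\<^sub>R (c h - c 0)) \<longlongrightarrow> u) (at 0)"
    by (rule Lim_null[THEN iffD2, OF tendsto_norm_zero_cancel])
  moreover have "filterlim t (at 0) sequentially"
    using t0 t(1) by (auto simp: filterlim_at intro!: always_eventually simp: less_imp_neq[THEN not_sym])
  ultimately have "(\<lambda>k. (1 / t k) *\<^sub>R (c (t k) - c 0)) \<longlonglongrightarrow> u"
    by (rule filterlim_compose)
  then show ?thesis
    unfolding tangent_cone_def a[symmetric] using t t0 b(2)
    by (intro CollectI exI[of _ t] exI[of _ "\<lambda>k. (1 / t k) *\<^sub>R (c (t k) - c 0)"])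
      (auto simp: less_imp_neq[THEN not_sym])
qed

text \<open>Along an approximating sequence \<open>f (a + t k *\<^sub>R w k) / t k\<close> tends to
  \<open>f' u\<close>, while the numerator is eventually zero. Equations valid on \<open>A\<close>
  near \<open>a\<close> thus linearize to equations on the cone, which gives all the upper estimates
  below.\<close>

lemma tangent_cone_derivative_zero:
  fixes f :: "'a::real_normed_vector \<Rightarrow> 'b::real_normed_vector"
  assumes u: "u \<in> tangent_cone A a"
    and der: "(f has_derivative f') (at a)"
    and "f a = 0"
    and zero: "\<forall>\<^sub>F z in nhds a. z \<in> A \<longrightarrow> f z = 0"
  shows "f' u = 0"
proof -
  obtain t w where t: "\<And>k. 0 < t k" "t \<longlonglongrightarrow> 0" and w: "w \<longlonglongrightarrow> u"
    and A: "\<And>k. a + t k *\<^sub>R w k \<in> A"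
    using u by (auto simp: tangent_cone_def)
  have lin: "bounded_linear f'"
    using der by (rule has_derivative_bounded_linear)
  have lim: "(\<lambda>k. a + t k *\<^sub>R w k) \<longlonglongrightarrow> a"
    using tendsto_add[OF tendsto_const tendsto_scaleR[OF t(2) w], of a] by simp
  have "norm (f' u) \<le> e * norm u" if "e > 0" for e
  proof -
    obtain d where d: "d > 0"
      "\<And>y. norm (y - a) < d \<Longrightarrow> norm (f y - f a - f' (y - a)) \<le> e * norm (y - a)"
      using der \<open>e > 0\<close> unfolding has_derivative_at_alt by metis
    have "\<forall>\<^sub>F k in sequentially. dist (a + t k *\<^sub>R w k) a < d"
      using lim d(1) by (rule tendstoD)
    moreover have "\<forall>\<^sub>F k in sequentially. f (a + t k *\<^sub>R w k) = 0"
      using eventually_compose_filterlim[OF zero lim] A by simp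
    ultimately have "\<forall>\<^sub>F k in sequentially. norm (f' (w k)) \<le> e * norm (w k)"
    proof eventually_elim
      case (elim k)
      have "t k * norm (f' (w k)) \<le> t k * (e * norm (w k))"
        using d(2)[of "a + t k *\<^sub>R w k"] elim t(1)[of k] \<open>f a = 0\<close>
        by (simp add: dist_norm linear_simps[OF lin] mult_ac)
      then show ?case
        using t(1)[of k] by simp
    qed
    then show ?thesis
      by (intro tendsto_le[OF _ tendsto_mult_left[OF tendsto_norm[OF w]]
            tendsto_norm[OF bounded_linear.tendsto[OF lin w]]]) auto
  qed
  note * = this
  have "norm (f' u) \<le> 0"
  proof (rule field_le_epsilon)
    fix e :: real assume "e > 0"
    \<comment> \<open>The summand 1 keeps the denominator positive when
      \<open>u = 0\<close>.\<close>
    have "norm (f' u) \<le> (e / (norm u + 1)) * norm u"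
      using \<open>e > 0\<close> by (intro *) (simp add: add_nonneg_pos)
    also have "\<dots> \<le> e"
      using \<open>e > 0\<close> by (simp add: divide_le_eq add_nonneg_pos mult_left_mono)
    finally show "norm (f' u) \<le> 0 + e" by simp
  qed
  then show ?thesis by simp
qed

section \<open>Convergence of subspaces\<close>

lemma orth_proj_props:
  fixes L :: "'a::euclidean_space set"
  assumes "subspace L"
  shows "orth_proj L x \<in> L" "x - orth_proj L x \<in> orthogonal_comp L"
  using theI'[OF orth_proj_unique[OF assms, of x]] by (auto simp: orth_proj_def)

lemma orth_proj_eqI:
  fixes L :: "'a::euclidean_space set"
  assumes "subspace L" "p \<in> L" "x - p \<in> orthogonal_comp L"
  shows "orth_proj L x = p"
  using orth_proj_unique[OF assms(1), of x] orth_proj_props[OF assms(1)] assms by blast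

lemma bounded_linear_orth_proj:
  fixes L :: "'a::euclidean_space set"
  assumes L: "subspace L"
  shows "bounded_linear (orth_proj L)"
  unfolding linear_conv_bounded_linear[symmetric]
proof (rule linearI)
  fix x y :: 'a and c :: real
  note P = orth_proj_props[OF L] and C = subspace_orthogonal_comp[of L]
  show "orth_proj L (x + y) = orth_proj L x + orth_proj L y"
    using subspace_add[OF C P(2) P(2), of x y]
    by (intro orth_proj_eqI[OF L] subspace_add[OF L] P) (simp add: algebra_simps)
  show "orth_proj L (c *\<^sub>R x) = c *\<^sub>R orth_proj L x"
    using subspace_scale[OF C P(2), of c x]
    by (intro orth_proj_eqI[OF L] subspace_scale[OF L] P) (simp add: algebra_simps)
qed

lemma dist_Zn_self [simp]: "dist_Zn L L = 0"
  by (simp add: dist_Zn_def onorm_zero)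

text \<open>The projection onto \<open>L1\<close> fixes \<open>x\<close>, so the left side is the
  difference of the two projections at \<open>x\<close>, bounded by its operator norm.\<close>

lemma norm_diff_orth_proj_le:
  assumes "subspace L1" "subspace L2" "x \<in> L1"
  shows "norm (x - orth_proj L2 x) \<le> dist_Zn L1 L2 * norm x"
proof -
  have "orth_proj L1 x = x"
    using assms by (intro orth_proj_eqI) (auto simp: subspace_0 subspace_orthogonal_comp)
  then show ?thesis
    using onorm[OF bounded_linear_sub[OF bounded_linear_orth_proj bounded_linear_orth_proj],
        OF assms(1,2), of x]
    by (simp add: dist_Zn_def)
qed

text \<open>It is enough to approximate the elements of the limit by elements of the subspaces in the
  sequence: this gives one inclusion, and the dimensions agree.\<close>

lemma Zn_limit_unique:
  fixes L T :: "((real^'n) \<times> (real^'n)) set"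
  assumes T: "T \<in> Zn" and L: "L \<in> Zn"
    and S: "\<forall>\<^sub>F k in sequentially. S k \<in> Zn"
    and lim: "(\<lambda>k. dist_Zn (S k) L) \<longlonglongrightarrow> 0"
    and appr: "\<And>x. x \<in> T \<Longrightarrow> \<exists>\<xi>. \<xi> \<longlonglongrightarrow> x \<and> (\<forall>\<^sub>F k in sequentially. \<xi> k \<in> S k)"
  shows "L = T"
proof -
  have sub: "subspace L" "subspace T" and dim: "dim T = dim L"
    using T L by (auto simp: Zn_def)
  have "x \<in> L" if x: "x \<in> T" for x
  proof -
    obtain \<xi> where \<xi>: "\<xi> \<longlonglongrightarrow> x" "\<forall>\<^sub>F k in sequentially. \<xi> k \<in> S k"
      using appr[OF x] by blast
    note P = bounded_linear_orth_proj[OF sub(1)]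
    have "(\<lambda>k. norm (\<xi> k - orth_proj L (\<xi> k))) \<longlonglongrightarrow> norm (x - orth_proj L x)"
      by (intro tendsto_intros \<xi>(1) bounded_linear.tendsto[OF P])
    moreover have "(\<lambda>k. dist_Zn (S k) L * norm (\<xi> k)) \<longlonglongrightarrow> 0 * norm x"
      by (intro tendsto_intros \<xi>(1) lim)
    \<comment> \<open>The distance from \<open>\<xi> k\<close> to \<open>L\<close> is controlled by
      the distance of the subspaces; in the limit \<open>x\<close> coincides with its projection
      onto \<open>L\<close>.\<close>
    moreover have "\<forall>\<^sub>F k in sequentially.
        norm (\<xi> k - orth_proj L (\<xi> k)) \<le> dist_Zn (S k) L * norm (\<xi> k)"
      using S \<xi>(2) by eventually_elim (auto intro!: norm_diff_orth_proj_le sub simp: Zn_def)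
    ultimately have "norm (x - orth_proj L x) \<le> 0 * norm x"
      by (intro tendsto_le[OF sequentially_bot])
    then have "x = orth_proj L x" by simp
    then show "x \<in> L"
      using orth_proj_props(1)[OF sub(1), of x] by simp
  qed
  then have "T \<subseteq> L" by blast
  then show ?thesis
    using subspace_dim_equal[OF sub(2,1)] dim by simp
qed

text \<open>A trivial common kernel makes the parametrization
  \<open>u \<mapsto> (A *v u, B *v u)\<close> injective, so its image has the dimension of the
  parameter space.\<close>

lemma rge_in_Zn:
  fixes A B :: "real^'n^'n"
  assumes "\<And>u. A *v u = 0 \<Longrightarrow> B *v u = 0 \<Longrightarrow> u = 0"
  shows "rge A B \<in> Zn"
proof -
  have lin: "linear (\<lambda>u. (A *v u, B *v u))"
    by (rule linearI) (auto simp: matrix_vector_right_distrib matrix_vector_mult_scaleR)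
  have eq: "rge A B = (\<lambda>u. (A *v u, B *v u)) ` UNIV"
    by (auto simp: rge_def)
  have "inj (\<lambda>u. (A *v u, B *v u))"
    using assms by (subst linear_injective_0[OF lin]) (auto simp: zero_prod_def)
  then have "dim (rge A B) = CARD('n)"
    unfolding eq by (subst dim_image_eq[OF lin]) auto
  then show ?thesis
    unfolding Zn_def eq using linear_subspace_image[OF lin subspace_UNIV] by simp
qed

section \<open>The graph of the friction mapping\<close>

lemma v12_nth [simp]: "v12 x $ 1 = x $ 1" "v12 x $ 2 = x $ 2"
  by (simp_all add: v12_def)

lemma vec21_nth [simp]:
  "vec21 g \<theta> $ 1 = g $ 1" "vec21 g \<theta> $ 2 = g $ 2" "vec21 g \<theta> $ 3 = \<theta>"
  by (simp_all add: vec21_def)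

lemma v12_vec21 [simp]: "v12 (vec21 g \<theta>) = g"
  by (simp add: vec_eq_iff forall_2)

lemma vec21_v12 [simp]: "vec21 (v12 x) (x $ 3) = x"
  by (simp add: vec_eq_iff forall_3)

lemma vec21_0 [simp]: "vec21 0 0 = 0"
  by (simp add: vec_eq_iff forall_3)

lemma vec3_eq_iff: "x = y \<longleftrightarrow> v12 x = v12 y \<and> x $ 3 = y $ 3" for x y :: "real^3"
  by (auto simp: vec_eq_iff forall_3 forall_2)

lemma inner_vec3: "x \<bullet> y = v12 x \<bullet> v12 y + x $ 3 * y $ 3" for x y :: "real^3"
  by (simp add: inner_vec_def sum_3 sum_2)

lemma bounded_linear_v12: "bounded_linear v12"
  unfolding linear_conv_bounded_linear[symmetric]
  by (rule linearI) (simp_all add: vec_eq_iff forall_2)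

lemmas v12_linear [simp] = linear_simps[OF bounded_linear_v12]

lemma bounded_linear_vec21: "bounded_linear (\<lambda>p. vec21 (fst p) (snd p))"
  unfolding linear_conv_bounded_linear[symmetric]
  by (rule linearI) (simp_all add: vec_eq_iff forall_3)

lemma tendsto_v12 [tendsto_intros]: "(f \<longlongrightarrow> a) F \<Longrightarrow> ((\<lambda>x. v12 (f x)) \<longlongrightarrow> v12 a) F"
  by (rule bounded_linear.tendsto[OF bounded_linear_v12])

lemma tendsto_vec21 [tendsto_intros]:
  "(f \<longlongrightarrow> a) F \<Longrightarrow> (g \<longlongrightarrow> b) F \<Longrightarrow> ((\<lambda>x. vec21 (f x) (g x)) \<longlongrightarrow> vec21 a b) F"
  using bounded_linear.tendsto[OF bounded_linear_vec21 tendsto_Pair] by simp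

text \<open>Testing the subgradient inequality at 0 and at \<open>2 *\<^sub>R w\<close> gives the
  equation, testing it at \<open>s\<close> then gives the bound; the converse is Cauchy-Schwarz.
  This form treats \<open>w = 0\<close> and \<open>w \<noteq> 0\<close> uniformly.\<close>

lemma convex_subdifferential_norm:
  "s \<in> convex_subdifferential norm w \<longleftrightarrow> norm s \<le> 1 \<and> s \<bullet> w = norm w"
  for w :: "'a::real_inner"
proof
  assume "s \<in> convex_subdifferential norm w"
  then have s: "norm w + s \<bullet> (z - w) \<le> norm z" for z
    by (simp add: convex_subdifferential_def)
  have eq: "s \<bullet> w = norm w"
    using s[of 0] s[of "2 *\<^sub>R w"] by (simp add: inner_diff_right)
  have "norm s * norm s \<le> norm s * 1"
    using s[of s] eq by (simp add: inner_diff_right dot_square_norm power2_eq_square)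
  then have "norm s \<le> 1"
    by (cases "s = 0") auto
  with eq show "norm s \<le> 1 \<and> s \<bullet> w = norm w" by simp
next
  assume s: "norm s \<le> 1 \<and> s \<bullet> w = norm w"
  have "s \<bullet> z \<le> norm z" for z
    using norm_cauchy_schwarz[of s z] mult_right_mono[of "norm s" 1 "norm z"] s by simp
  then show "s \<in> convex_subdifferential norm w"
    using s by (simp add: convex_subdifferential_def inner_diff_right)
qed

lemma normal_cone_nonneg: "s \<in> normal_cone {0..} x \<longleftrightarrow> x \<ge> 0 \<and> s \<le> 0 \<and> x * s = 0" for x s :: real
proof
  assume "s \<in> normal_cone {0..} x"
  then have x: "x \<ge> 0" and s: "\<And>z. z \<ge> 0 \<Longrightarrow> s * (z - x) \<le> 0"
    by (auto simp: normal_cone_def split: if_splits)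
  show "x \<ge> 0 \<and> s \<le> 0 \<and> x * s = 0"
    \<comment> \<open>The points 0 and \<open>2 * x\<close> give the two inequalities for
      \<open>x * s = 0\<close>; the point \<open>x + 1\<close> gives the sign of
      \<open>s\<close>.\<close>
    using x s[of 0] s[of "2 * x"] s[of "x + 1"] by (simp add: algebra_simps)
next
  assume "x \<ge> 0 \<and> s \<le> 0 \<and> x * s = 0"
  then show "s \<in> normal_cone {0..} x"
    by (auto simp: normal_cone_def algebra_simps mult_nonneg_nonpos)
qed

text \<open>This eliminates the subgradient: for negative \<open>y $ 3\<close> it is recovered from
  \<open>v12 y\<close> by division, and for \<open>y $ 3 = 0\<close> the vector \<open>v12 y\<close>
  is zero whichever subgradient is taken.\<close>

lemma gph_Qt_iff:
  assumes "\<F> > 0"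
  shows "(x, y) \<in> gph (Qt \<F>) \<longleftrightarrow> x $ 3 \<ge> 0 \<and> y $ 3 \<le> 0 \<and> x $ 3 * y $ 3 = 0 \<and>
    norm (v12 y) \<le> - \<F> * y $ 3 \<and> v12 y \<bullet> v12 x = - \<F> * y $ 3 * norm (v12 x)"
proof -
  have mem: "(x, y) \<in> gph (Qt \<F>) \<longleftrightarrow> x $ 3 \<ge> 0 \<and> y $ 3 \<le> 0 \<and> x $ 3 * y $ 3 = 0 \<and>
      (\<exists>s. v12 y = (- \<F> * y $ 3) *\<^sub>R s \<and> norm s \<le> 1 \<and> s \<bullet> v12 x = norm (v12 x))"
    by (auto simp: gph_def Qt_def vec3_eq_iff normal_cone_nonneg convex_subdifferential_norm image_iff)
  show ?thesis
  proof (cases "y $ 3 = 0")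
    case True
    \<comment> \<open>Here only nonemptiness of the subdifferential matters; \<open>sgn\<close>
      supplies an element, with value 0 at the origin.\<close>
    have "\<exists>s. norm s \<le> 1 \<and> s \<bullet> v12 x = norm (v12 x)"
      by (intro exI[of _ "sgn (v12 x)"], cases "v12 x = 0")
        (simp_all add: norm_sgn sgn_div_norm dot_square_norm power2_eq_square)
    then show ?thesis
      using True by (auto simp: mem)
  next
    case False
    show ?thesis
    proof (intro mem[THEN trans] conj_cong refl iffI)
      assume y: "y $ 3 \<le> 0"
      then have pos: "- \<F> * y $ 3 > 0"
        using False assms by (simp add: mult_pos_neg)
      {
        assume "\<exists>s. v12 y = (- \<F> * y $ 3) *\<^sub>R s \<and> norm s \<le> 1 \<and> s \<bullet> v12 x = norm (v12 x)"
        then obtain s where s: "v12 y = (- \<F> * y $ 3) *\<^sub>R s" "norm s \<le> 1" "s \<bullet> v12 x = norm (v12 x)"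
          by blast
        have "norm (v12 y) = (- \<F> * y $ 3) * norm s"
          using s(1) pos by simp
        also have "\<dots> \<le> (- \<F> * y $ 3) * 1"
          using s(2) pos by (intro mult_left_mono) auto
        finally show "norm (v12 y) \<le> - \<F> * y $ 3 \<and> v12 y \<bullet> v12 x = - \<F> * y $ 3 * norm (v12 x)"
          using s by simp
      next
        assume "norm (v12 y) \<le> - \<F> * y $ 3 \<and> v12 y \<bullet> v12 x = - \<F> * y $ 3 * norm (v12 x)"
        then show "\<exists>s. v12 y = (- \<F> * y $ 3) *\<^sub>R s \<and> norm s \<le> 1 \<and> s \<bullet> v12 x = norm (v12 x)"
          using pos by (intro exI[of _ "(1 / (- \<F> * y $ 3)) *\<^sub>R v12 y"]) (auto simp: field_simps)
      }
    qed
  qed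
qed


lemma gph_Qt_nonpos:
  assumes "\<F> > 0" "y $ 3 < 0"
  shows "(x, y) \<in> gph (Qt \<F>) \<longleftrightarrow> x $ 3 = 0 \<and>
    norm (v12 y) \<le> - \<F> * y $ 3 \<and> v12 y \<bullet> v12 x = - \<F> * y $ 3 * norm (v12 x)"
  using assms by (auto simp: gph_Qt_iff)

lemma gph_Qt_zero:
  assumes "\<F> > 0" "y $ 3 = 0"
  shows "(x, y) \<in> gph (Qt \<F>) \<longleftrightarrow> x $ 3 \<ge> 0 \<and> y = 0"
  using assms by (auto simp: gph_Qt_iff vec3_eq_iff[of y])

lemma gph_Qt_pos:
  assumes "\<F> > 0" "x $ 3 > 0"
  shows "(x, y) \<in> gph (Qt \<F>) \<longleftrightarrow> y = 0"
  using assms gph_Qt_zero[of \<F> y x] by (auto simp: gph_Qt_iff)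

text \<open>This is the equality case of Cauchy-Schwarz: the squared distance from
  \<open>v12 y\<close> to \<open>(c / n) *\<^sub>R v12 x\<close> equals the squared norm of
  \<open>v12 y\<close> minus \<open>c\<^sup>2\<close>. The resulting equation is smooth where
  \<open>v12 x \<noteq> 0\<close>.\<close>

lemma gph_Qt_slip:
  assumes "\<F> > 0" "y $ 3 < 0" "v12 x \<noteq> 0"
  shows "(x, y) \<in> gph (Qt \<F>) \<longleftrightarrow> x $ 3 = 0 \<and>
    v12 y + (\<F> * y $ 3 / norm (v12 x)) *\<^sub>R v12 x = 0"
proof -
  define c where "c = - \<F> * y $ 3"
  have c: "c > 0"
    using assms by (simp add: c_def mult_pos_neg)
  define n where "n = norm (v12 x)"
  have n: "n > 0" and nn: "v12 x \<bullet> v12 x = n * n"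
    using assms by (simp_all add: n_def dot_square_norm power2_eq_square)
  have "norm (v12 y) \<le> c \<and> v12 y \<bullet> v12 x = c * n \<longleftrightarrow> v12 y - (c / n) *\<^sub>R v12 x = 0"
  proof
    assume *: "norm (v12 y) \<le> c \<and> v12 y \<bullet> v12 x = c * n"
    have "(norm (v12 y - (c / n) *\<^sub>R v12 x))\<^sup>2 = (norm (v12 y))\<^sup>2 - c\<^sup>2"
      using * n c dot_norm_neg[of "v12 y" "(c / n) *\<^sub>R v12 x"]
      by (simp add: n_def[symmetric] field_simps power2_eq_square)
    also have "\<dots> \<le> 0"
      using * by (simp add: power_mono)
    finally show "v12 y - (c / n) *\<^sub>R v12 x = 0" by simp
  next
    assume "v12 y - (c / n) *\<^sub>R v12 x = 0"
    then have "v12 y = (c / n) *\<^sub>R v12 x" by simp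
    then show "norm (v12 y) \<le> c \<and> v12 y \<bullet> v12 x = c * n"
      using n c by (simp add: nn n_def[symmetric])
  qed
  then show ?thesis
    using gph_Qt_nonpos[OF assms(1,2)] by (simp add: c_def n_def)
qed

lemma set_L_iff:
  "(x, y) \<in> set_L \<F> \<longleftrightarrow> (x, y) \<in> gph (Qt \<F>) \<and> x $ 3 > 0 \<and> y $ 3 = 0"
  by (auto simp: set_L_def) (metis vec21_v12)

lemma set_M1_iff:
  "(x, y) \<in> set_M1 \<F> \<longleftrightarrow> (x, y) \<in> gph (Qt \<F>) \<and> x $ 3 = 0 \<and> y $ 3 < 0 \<and> v12 x \<noteq> 0"
  by (auto simp: set_M1_def intro!: exI[of _ "v12 y"] exI[of _ "y $ 3"])

lemma set_M3p_iff:
  "(x, y) \<in> set_M3p \<F> \<longleftrightarrow> (x, y) \<in> gph (Qt \<F>) \<and> x $ 3 = 0 \<and> y $ 3 < 0 \<and> v12 x = 0 \<and>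
    norm (v12 y) < - \<F> * y $ 3"
  by (auto simp: set_M3p_def intro!: exI[of _ "v12 y"] exI[of _ "y $ 3"])

section \<open>The candidate tangent spaces\<close>

lemma block_mult:
  "block A b c d *v u = vec21 (A *v v12 u + u $ 3 *\<^sub>R b) (c \<bullet> v12 u + d * u $ 3)"
  by (simp add: vec_eq_iff forall_3 block_def matrix_vector_mult_def sum_3 sum_2 inner_vec_def)

lemma outer_mult: "outer w *v p = (w \<bullet> p) *\<^sub>R w"
  by (simp add: vec_eq_iff forall_2 outer_def matrix_matrix_mult_def columnvector_def rowvector_def
      matrix_vector_mult_def sum_2 inner_vec_def algebra_simps)

text \<open>The Jacobian of \<open>w \<mapsto> (- \<F> * \<theta> / norm w) *\<^sub>R w\<close> at
  nonzero \<open>w\<close>: a multiple of the orthogonal projection onto the complement of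
  \<open>w\<close>.\<close>

definition slip_curv :: "real \<Rightarrow> real \<Rightarrow> real^2 \<Rightarrow> real^2^2" where
  "slip_curv \<F> \<theta> w = (- \<F> * \<theta> * (1 / norm w)) *\<^sub>R (mat 1 - (1 / (norm w)\<^sup>2) *\<^sub>R outer w)"

lemma slip_curv_mult:
  "slip_curv \<F> \<theta> w *v p = (- \<F> * \<theta> * (1 / norm w)) *\<^sub>R (p - ((w \<bullet> p) / (norm w)\<^sup>2) *\<^sub>R w)"
  by (simp only: slip_curv_def scaleR_matrix_vector_assoc[symmetric] matrix_vector_mult_diff_rdistrib
      outer_mult matrix_vector_mul_lid) simp

text \<open>Symmetry of the Jacobian, which moves it to the other factor when orthogonal complements
  are computed.\<close>

lemma inner_slip_curv: "q \<bullet> (slip_curv \<F> \<theta> w *v p) = p \<bullet> (slip_curv \<F> \<theta> w *v q)"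
  by (simp add: slip_curv_mult inner_diff_right inner_commute)

definition slip_tangent :: "real \<Rightarrow> real \<Rightarrow> real^2 \<Rightarrow> ((real^3) \<times> (real^3)) set" where
  "slip_tangent \<F> \<theta> w =
    rge (block (mat 1) 0 0 0) (block (slip_curv \<F> \<theta> w) ((- \<F> / norm w) *\<^sub>R w) 0 1)"

definition slip_adjoint :: "real \<Rightarrow> real \<Rightarrow> real^2 \<Rightarrow> ((real^3) \<times> (real^3)) set" where
  "slip_adjoint \<F> \<theta> w =
    rge (block (mat 1) 0 ((\<F> / norm w) *\<^sub>R w) 0) (block (slip_curv \<F> \<theta> w) 0 0 1)"

text \<open>Passing from a parametrization to equations is possible because the parameter can be
  read off: its first two components are \<open>v12 a\<close>, its third is
  \<open>b $ 3\<close>.\<close>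

lemma slip_tangent_iff:
  "(a, b) \<in> slip_tangent \<F> \<theta> w \<longleftrightarrow>
    a $ 3 = 0 \<and> v12 b = slip_curv \<F> \<theta> w *v v12 a - (\<F> * b $ 3 / norm w) *\<^sub>R w"
  unfolding slip_tangent_def rge_def block_mult
  by (auto simp: vec3_eq_iff intro!: exI[of _ "vec21 (v12 a) (b $ 3)"])

lemma slip_adjoint_iff:
  "(a, b) \<in> slip_adjoint \<F> \<theta> w \<longleftrightarrow>
    a $ 3 = \<F> / norm w * (w \<bullet> v12 a) \<and> v12 b = slip_curv \<F> \<theta> w *v v12 a"
  unfolding slip_adjoint_def rge_def block_mult
  by (auto simp: vec3_eq_iff intro!: exI[of _ "vec21 (v12 a) (b $ 3)"])

lemma slip_tangent_Zn: "slip_tangent \<F> \<theta> w \<in> Zn"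
  unfolding slip_tangent_def by (rule rge_in_Zn) (auto simp: block_mult vec3_eq_iff)

lemma slip_adjoint_Zn: "slip_adjoint \<F> \<theta> w \<in> Zn"
  unfolding slip_adjoint_def by (rule rge_in_Zn) (auto simp: block_mult vec3_eq_iff)

text \<open>On the tangent space \<open>v12 a\<close> and \<open>b $ 3\<close> vary freely.
  Eliminating \<open>v12 b\<close> turns the inner product with \<open>(u, v)\<close> into a linear
  form in these parameters; its two coefficients vanish exactly when \<open>(- v, u)\<close>
  satisfies the equations of \<open>slip_adjoint\<close>.\<close>

lemma adj_slip_tangent: "adj_subspace (slip_tangent \<F> \<theta> w) = slip_adjoint \<F> \<theta> w"
proof -
  have "(- v, u) \<in> slip_adjoint \<F> \<theta> w \<longleftrightarrow> (u, v) \<in> orthogonal_comp (slip_tangent \<F> \<theta> w)" for u v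
  proof -
    let ?B = "slip_curv \<F> \<theta> w"
    let ?r = "v12 u + ?B *v v12 v" and ?s = "v $ 3 - \<F> / norm w * (w \<bullet> v12 v)"
    have *: "(u, v) \<bullet> (a, b) = v12 a \<bullet> ?r + b $ 3 * ?s"
      if "a $ 3 = 0" "v12 b = ?B *v v12 a - (\<F> * b $ 3 / norm w) *\<^sub>R w" for a b
      unfolding inner_Pair inner_vec3 that
      by (simp add: inner_diff_right inner_add_right inner_slip_curv[of "v12 v"]
          inner_commute[of _ w] inner_commute[of "v12 u"] algebra_simps)
    have "(u, v) \<in> orthogonal_comp (slip_tangent \<F> \<theta> w) \<longleftrightarrow>
        (\<forall>z \<in> slip_tangent \<F> \<theta> w. (u, v) \<bullet> z = 0)"
      by (simp add: orthogonal_comp_def orthogonal_def inner_commute del: inner_Pair)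
    also have "\<dots> \<longleftrightarrow>
        (\<forall>a b. a $ 3 = 0 \<and> v12 b = ?B *v v12 a - (\<F> * b $ 3 / norm w) *\<^sub>R w \<longrightarrow>
          v12 a \<bullet> ?r + b $ 3 * ?s = 0)"
      by (simp add: Ball_def slip_tangent_iff * del: inner_Pair cong: imp_cong)
    also have "\<dots> \<longleftrightarrow> ?r = 0 \<and> ?s = 0"
    proof
      assume H: "\<forall>a b. a $ 3 = 0 \<and> v12 b = ?B *v v12 a - (\<F> * b $ 3 / norm w) *\<^sub>R w \<longrightarrow>
          v12 a \<bullet> ?r + b $ 3 * ?s = 0"
      show "?r = 0 \<and> ?s = 0"
        \<comment> \<open>The first test pair has \<open>v12 a = ?r\<close> and
          \<open>b $ 3 = 0\<close>, leaving \<open>?r \<bullet> ?r = 0\<close>; the second has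
          \<open>a = 0\<close> and \<open>b $ 3 = 1\<close>, isolating \<open>?s\<close>.\<close>
        using H[rule_format, of "vec21 ?r 0" "vec21 (?B *v ?r) 0"]
          H[rule_format, of "vec21 0 0" "vec21 (- (\<F> / norm w) *\<^sub>R w) 1"] by simp
    qed simp
    also have "\<dots> \<longleftrightarrow> (- v, u) \<in> slip_adjoint \<F> \<theta> w"
      by (auto simp: slip_adjoint_iff matrix_vector_mult_diff_distrib[of _ 0, simplified] add_eq_0_iff)
    finally show ?thesis by simp
  qed
  then show ?thesis
    unfolding adj_subspace_def by (auto simp: minus_equation_iff) (metis minus_minus)
qed

lemma rge_mat_0_iff: "(a, b) \<in> rge (mat 1) 0 \<longleftrightarrow> b = 0"
  by (auto simp: rge_def)

lemma rge_0_mat_iff: "(a, b) \<in> rge 0 (mat 1) \<longleftrightarrow> a = 0"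
  by (auto simp: rge_def)

lemma rge_mat_0_Zn: "rge (mat 1) 0 \<in> Zn"
  by (rule rge_in_Zn) simp

lemma rge_0_mat_Zn: "rge 0 (mat 1) \<in> Zn"
  by (rule rge_in_Zn) simp

lemma adj_rge_mat_0:
  "adj_subspace (rge (mat 1) 0 :: ((real^'n) \<times> (real^'n)) set) = rge (mat 1) 0"
proof -
  have "(u, v) \<in> orthogonal_comp (rge (mat 1) 0) \<longleftrightarrow> u = 0" for u v :: "real^'n"
    by (auto simp: orthogonal_comp_def orthogonal_def rge_mat_0_iff dest: bspec[of _ _ "(u, 0)"])
  then show ?thesis
    by (auto simp: adj_subspace_def rge_mat_0_iff) (metis minus_minus)
qed

lemma adj_rge_0_mat:
  "adj_subspace (rge 0 (mat 1) :: ((real^'n) \<times> (real^'n)) set) = rge 0 (mat 1)"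
proof -
  have "(u, v) \<in> orthogonal_comp (rge 0 (mat 1)) \<longleftrightarrow> v = 0" for u v :: "real^'n"
    by (auto simp: orthogonal_comp_def orthogonal_def rge_0_mat_iff dest: bspec[of _ _ "(0, v)"])
  then show ?thesis
    by (auto simp: adj_subspace_def rge_0_mat_iff)
qed

section \<open>Tangent cones to the graph of the friction mapping\<close>

text \<open>The amount by which \<open>v12 y\<close> misses the slip law. Subtracting it from
  \<open>v12 y\<close> leaves \<open>x\<close> and \<open>y $ 3\<close> alone and makes the new
  residual zero.\<close>

definition slip_residual :: "real \<Rightarrow> (real^3) \<times> (real^3) \<Rightarrow> real^2" where
  "slip_residual \<F> z = v12 (snd z) + (\<F> * snd z $ 3 / norm (v12 (fst z))) *\<^sub>R v12 (fst z)"

text \<open>The derivative is written so that its zeros with \<open>fst d $ 3 = 0\<close> are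
  visibly the elements of \<open>slip_tangent\<close>.\<close>

lemma slip_residual_derivative:
  assumes "v12 x \<noteq> 0"
  shows "(slip_residual \<F> has_derivative (\<lambda>d. v12 (snd d) -
    (slip_curv \<F> (y $ 3) (v12 x) *v v12 (fst d) - (\<F> * snd d $ 3 / norm (v12 x)) *\<^sub>R v12 x))) (at (x, y))"
proof -
  define n where "n = norm (v12 x)"
  have n: "n > 0"
    using assms by (simp add: n_def)
  have fst': "((\<lambda>z. v12 (fst z)) has_derivative (\<lambda>d. v12 (fst d))) (at (x, y))"
    and snd': "((\<lambda>z. v12 (snd z)) has_derivative (\<lambda>d. v12 (snd d))) (at (x, y))"
    by (rule bounded_linear_imp_has_derivative bounded_linear_compose[OF bounded_linear_v12]
        bounded_linear_fst bounded_linear_snd)+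
  have nth': "((\<lambda>z. snd z $ 3) has_derivative (\<lambda>d. snd d $ 3)) (at (x, y))"
    by (rule bounded_linear_imp_has_derivative bounded_linear_compose[OF bounded_linear_vec_nth]
        bounded_linear_snd)+
  have norm': "((\<lambda>z. norm (v12 (fst z))) has_derivative (\<lambda>d. v12 (fst d) \<bullet> sgn (v12 x))) (at (x, y))"
    using has_derivative_compose[OF fst', of norm "\<lambda>h. h \<bullet> sgn (v12 x)"] has_derivative_norm[of "v12 x"] assms
    by simp
  \<comment> \<open>Rewrites the outcome of the quotient rule as the \<open>\<theta>\<close>-part
    plus the radial part of \<open>slip_curv\<close>.\<close>
  have eq: "(\<F> * s * n - \<F> * y $ 3 * (inverse n * q)) / (n * n)
      = \<F> * s / n - \<F> * y $ 3 / n * (q / n\<^sup>2)" for s q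
    using n by (simp add: field_simps power2_eq_square)
  show ?thesis
    unfolding slip_residual_def[abs_def]
    using assms n
    by (auto intro!: derivative_eq_intros fst' snd' nth' norm' ext
        simp: slip_curv_mult n_def[symmetric] sgn_div_norm)
      (simp add: eq scaleR_diff_left scaleR_diff_right inner_commute)
qed

lemma nhds_tendsto_pair:
  "((\<lambda>z. fst z) \<longlongrightarrow> x) (nhds (x, y))" "((\<lambda>z. snd z) \<longlongrightarrow> y) (nhds (x, y))"
  using tendsto_fst[OF filterlim_ident] tendsto_snd[OF filterlim_ident] by fastforce+

text \<open>Near the point \<open>x $ 3\<close> stays positive, so the graph is locally the subspace
  \<open>y = 0\<close>. One inclusion differentiates \<open>snd\<close>, the other uses straight
  lines.\<close>

lemma tangent_cone_L:
  assumes F: "\<F> > 0" and z: "(x, y) \<in> gph (Qt \<F>)" "x $ 3 > 0"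
  shows "tangent_cone (gph (Qt \<F>)) (x, y) = rge (mat 1) 0"
proof (intro set_eqI iffI; clarify)
  have y: "y = 0"
    using gph_Qt_pos F z by blast
  fix a b :: "real^3"
  {
    assume "(a, b) \<in> tangent_cone (gph (Qt \<F>)) (x, y)"
    then have "snd (a, b) = 0"
    proof (rule tangent_cone_derivative_zero)
      show "(snd has_derivative snd) (at (x, y))"
        by (rule bounded_linear_imp_has_derivative bounded_linear_snd)+
      have "\<forall>\<^sub>F z in nhds (x, y). fst z $ 3 > 0"
        by (rule order_tendstoD(1)[OF _ z(2)]) (intro tendsto_intros nhds_tendsto_pair)
      then show "\<forall>\<^sub>F z in nhds (x, y). z \<in> gph (Qt \<F>) \<longrightarrow> snd z = 0"
        by eventually_elim (use gph_Qt_pos[OF F] in auto)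
    qed (simp add: y)
    then show "(a, b) \<in> rge (mat 1) 0"
      by (simp add: rge_mat_0_iff)
  next
    assume "(a, b) \<in> rge (mat 1) 0"
    then have b: "b = 0"
      by (simp add: rge_mat_0_iff)
    show "(a, b) \<in> tangent_cone (gph (Qt \<F>)) (x, y)"
    proof (rule tangent_coneI_curve)
      show "((\<lambda>t. (x + t *\<^sub>R a, 0)) has_vector_derivative (a, b)) (at 0)"
        unfolding b by (auto intro!: derivative_eq_intros)
      have "\<forall>\<^sub>F t in at_right 0. (x + t *\<^sub>R a) $ 3 > 0"
        by (rule order_tendstoD(1)[of _ "(x + 0 *\<^sub>R a) $ 3"]) (use z in \<open>auto intro!: tendsto_eq_intros\<close>)
      then show "\<forall>\<^sub>F t in at_right 0. (x + t *\<^sub>R a, 0) \<in> gph (Qt \<F>)"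
        by eventually_elim (use gph_Qt_pos[OF F] in auto)
    qed (simp add: y)
  }
qed

lemma nhds_M3p:
  assumes "\<F> > 0" "y $ 3 < 0" "norm (v12 y) < - \<F> * y $ 3"
  shows "\<forall>\<^sub>F z in nhds (x, y). snd z $ 3 < 0 \<and> norm (v12 (snd z)) < - \<F> * snd z $ 3"
proof -
  have "\<forall>\<^sub>F z in nhds (x, y). snd z $ 3 < 0"
    by (rule order_tendstoD(2)[OF _ assms(2)]) (intro tendsto_intros nhds_tendsto_pair)
  moreover have "\<forall>\<^sub>F z in nhds (x, y). norm (v12 (snd z)) - (- \<F> * snd z $ 3) < 0"
    by (rule order_tendstoD(2)[of _ "norm (v12 y) - (- \<F> * y $ 3)"], intro tendsto_intros nhds_tendsto_pair)
      (use assms in simp)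
  ultimately show ?thesis
    by eventually_elim auto
qed

text \<open>A nonzero \<open>v12 x\<close> would make the inner product equal to something strictly
  larger than the Cauchy-Schwarz bound.\<close>

lemma gph_Qt_stick:
  assumes "\<F> > 0" "y $ 3 < 0" "norm (v12 y) < - \<F> * y $ 3"
  shows "(x, y) \<in> gph (Qt \<F>) \<longleftrightarrow> x = 0"
proof
  assume "(x, y) \<in> gph (Qt \<F>)"
  then have x: "x $ 3 = 0" "v12 y \<bullet> v12 x = - \<F> * y $ 3 * norm (v12 x)"
    using gph_Qt_nonpos assms by auto
  have "v12 x = 0"
  proof (rule ccontr)
    assume "v12 x \<noteq> 0"
    then have "norm (v12 y) * norm (v12 x) < - \<F> * y $ 3 * norm (v12 x)"
      using assms by (intro mult_strict_right_mono) auto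
    then show False
      using x(2) norm_cauchy_schwarz[of "v12 y" "v12 x"] by simp
  qed
  with x(1) show "x = 0"
    by (simp add: vec3_eq_iff)
qed (use assms gph_Qt_nonpos in auto)

lemma tangent_cone_M3p:
  assumes F: "\<F> > 0" and y: "y $ 3 < 0" "norm (v12 y) < - \<F> * y $ 3"
  shows "tangent_cone (gph (Qt \<F>)) (0, y) = rge 0 (mat 1)"
proof (intro set_eqI iffI; clarify)
  fix a b :: "real^3"
  {
    assume "(a, b) \<in> tangent_cone (gph (Qt \<F>)) (0, y)"
    then have "fst (a, b) = 0"
    proof (rule tangent_cone_derivative_zero)
      show "(fst has_derivative fst) (at (0, y))"
        by (rule bounded_linear_imp_has_derivative bounded_linear_fst)+
      show "\<forall>\<^sub>F z in nhds (0, y). z \<in> gph (Qt \<F>) \<longrightarrow> fst z = 0"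
        using nhds_M3p[OF F y] by eventually_elim (use gph_Qt_stick[OF F] in auto)
    qed simp
    then show "(a, b) \<in> rge 0 (mat 1)"
      by (simp add: rge_0_mat_iff)
  next
    assume "(a, b) \<in> rge 0 (mat 1)"
    then have a: "a = 0"
      by (simp add: rge_0_mat_iff)
    show "(a, b) \<in> tangent_cone (gph (Qt \<F>)) (0, y)"
    proof (rule tangent_coneI_curve)
      show "((\<lambda>t. (0, y + t *\<^sub>R b)) has_vector_derivative (a, b)) (at 0)"
        unfolding a by (auto intro!: derivative_eq_intros)
      have "((\<lambda>t. (0 :: real^3, y + t *\<^sub>R b)) \<longlongrightarrow> (0, y + 0 *\<^sub>R b)) (at_right 0)"
        by (intro tendsto_intros)
      then have "filterlim (\<lambda>t. (0 :: real^3, y + t *\<^sub>R b)) (nhds (0, y)) (at_right 0)"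
        by simp
      from eventually_compose_filterlim[OF nhds_M3p[OF F y] this]
      show "\<forall>\<^sub>F t in at_right 0. (0, y + t *\<^sub>R b) \<in> gph (Qt \<F>)"
        by eventually_elim (use gph_Qt_stick[OF F] in auto)
    qed simp
  }
qed

lemma nhds_M1:
  fixes x y :: "real^3"
  assumes "y $ 3 < 0" "v12 x \<noteq> 0"
  shows "\<forall>\<^sub>F z in nhds (x, y). snd z $ 3 < 0 \<and> v12 (fst z) \<noteq> 0"
proof -
  have "\<forall>\<^sub>F z in nhds (x, y). snd z $ 3 < 0"
    by (rule order_tendstoD(2)[OF _ assms(1)]) (intro tendsto_intros nhds_tendsto_pair)
  moreover have "\<forall>\<^sub>F z in nhds (x, y). v12 (fst z) \<noteq> 0"
    by (rule tendsto_imp_eventually_ne[OF _ assms(2)]) (intro tendsto_intros nhds_tendsto_pair)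
  ultimately show ?thesis
    by eventually_elim auto
qed

text \<open>Linearizing \<open>x $ 3 = 0\<close> and the slip equation bounds the cone from above.
  Conversely, a tangent line leaves the graph only to higher order, so pushing it back does not
  change its velocity.\<close>

lemma tangent_cone_M1:
  assumes F: "\<F> > 0" and z: "(x, y) \<in> gph (Qt \<F>)" and y: "y $ 3 < 0" and x: "v12 x \<noteq> 0"
  shows "tangent_cone (gph (Qt \<F>)) (x, y) = slip_tangent \<F> (y $ 3) (v12 x)"
proof (intro set_eqI iffI; clarify)
  note res = slip_residual_derivative[OF x, of \<F> y]
  have x3: "x $ 3 = 0" and res0: "slip_residual \<F> (x, y) = 0"
    using z gph_Qt_slip[OF F y x] by (auto simp: slip_residual_def)
  fix a b :: "real^3"
  {
    assume ab: "(a, b) \<in> tangent_cone (gph (Qt \<F>)) (x, y)"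
    have "fst (a, b) $ 3 = 0"
    proof (rule tangent_cone_derivative_zero[OF ab])
      show "((\<lambda>z. fst z $ 3) has_derivative (\<lambda>z. fst z $ 3)) (at (x, y))"
        by (rule bounded_linear_imp_has_derivative bounded_linear_compose[OF bounded_linear_vec_nth]
            bounded_linear_fst)+
      show "\<forall>\<^sub>F z in nhds (x, y). z \<in> gph (Qt \<F>) \<longrightarrow> fst z $ 3 = 0"
        using nhds_M1[OF y x] by eventually_elim (use gph_Qt_slip[OF F] in auto)
    qed (simp add: x3)
    moreover have "v12 (snd (a, b)) - (slip_curv \<F> (y $ 3) (v12 x) *v v12 (fst (a, b)) -
        (\<F> * snd (a, b) $ 3 / norm (v12 x)) *\<^sub>R v12 x) = 0"
    proof (rule tangent_cone_derivative_zero[OF ab res res0])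
      show "\<forall>\<^sub>F z in nhds (x, y). z \<in> gph (Qt \<F>) \<longrightarrow> slip_residual \<F> z = 0"
        using nhds_M1[OF y x]
        by eventually_elim (use gph_Qt_slip[OF F] in \<open>auto simp: slip_residual_def\<close>)
    qed
    ultimately show "(a, b) \<in> slip_tangent \<F> (y $ 3) (v12 x)"
      by (simp add: slip_tangent_iff)
  next
    assume "(a, b) \<in> slip_tangent \<F> (y $ 3) (v12 x)"
    then have a: "a $ 3 = 0"
      and b: "v12 b - (slip_curv \<F> (y $ 3) (v12 x) *v v12 a - (\<F> * b $ 3 / norm (v12 x)) *\<^sub>R v12 x) = 0"
      by (auto simp: slip_tangent_iff)
    define c where "c t = (x + t *\<^sub>R a, y + t *\<^sub>R b)" for t :: real
    have line: "((\<lambda>t. p + t *\<^sub>R q) has_derivative (\<lambda>t. t *\<^sub>R q)) (at 0)" for p q :: "real^3"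
      by (auto intro!: derivative_eq_intros)
    have c: "(c has_derivative (\<lambda>t. (t *\<^sub>R a, t *\<^sub>R b))) (at 0)"
      unfolding c_def[abs_def] by (intro has_derivative_Pair line)
    have c0: "c 0 = (x, y)"
      by (simp add: c_def)
    define r where "r d = v12 (snd d) - (slip_curv \<F> (y $ 3) (v12 x) *v v12 (fst d) -
        (\<F> * snd d $ 3 / norm (v12 x)) *\<^sub>R v12 x)" for d :: "(real^3) \<times> (real^3)"
    have r: "r (t *\<^sub>R a, t *\<^sub>R b) = 0" for t
    proof -
      have "r (t *\<^sub>R a, t *\<^sub>R b) = t *\<^sub>R r (a, b)"
        by (simp add: r_def matrix_vector_mult_scaleR scaleR_diff_right mult.left_commute)
      also have "r (a, b) = 0"
        using b by (simp only: r_def fst_conv snd_conv)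
      finally show ?thesis by simp
    qed
    have "(slip_residual \<F> has_derivative r) (at (c 0))"
      using res unfolding c0 r_def[abs_def] .
    \<comment> \<open>The direction \<open>(a, b)\<close> lies in the kernel of the derivative of
      the residual, so the correction has zero velocity at 0.\<close>
    from has_derivative_compose[OF c this]
    have "((\<lambda>t. slip_residual \<F> (c t)) has_derivative (\<lambda>t. 0)) (at 0)"
      by (simp only: r)
    from bounded_linear.has_derivative[OF bounded_linear_vec21 has_derivative_Pair[OF this has_derivative_const[of 0]]]
    have corr: "((\<lambda>t. vec21 (slip_residual \<F> (c t)) 0) has_derivative (\<lambda>t. 0)) (at 0)"
      by simp
    have lim: "filterlim c (nhds (x, y)) (at_right 0)"
      unfolding c0[symmetric] c_def[abs_def] by (intro tendsto_intros)
    \<comment> \<open>A tangent line, corrected in the \<open>g\<close>-component by the residual so as to stay in the graph.\<close>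
    show "(a, b) \<in> tangent_cone (gph (Qt \<F>)) (x, y)"
    proof (rule tangent_coneI_curve)
      show "((\<lambda>t. (x + t *\<^sub>R a, y + t *\<^sub>R b - vec21 (slip_residual \<F> (c t)) 0)) has_vector_derivative (a, b)) (at 0)"
        using has_derivative_Pair[OF line has_derivative_diff[OF line corr]]
        by (simp add: has_vector_derivative_def)
      show "\<forall>\<^sub>F t in at_right 0. (x + t *\<^sub>R a, y + t *\<^sub>R b - vec21 (slip_residual \<F> (c t)) 0) \<in> gph (Qt \<F>)"
        using eventually_compose_filterlim[OF nhds_M1[OF y x] lim]
      proof eventually_elim
        case (elim t)
        then show ?case
          by (subst gph_Qt_slip[OF F]) (auto simp: c_def slip_residual_def a x3)
      qed
    qed (simp add: res0 c0)
  }
qed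

section \<open>Limits of tangent spaces\<close>

text \<open>The map \<open>tg\<close> stands for the identity or for \<open>adj_subspace\<close>, so
  both limiting constructions are covered at once. Continuity of the matrices lets each element of
  the limit be approximated with its parameter \<open>u\<close> kept fixed; the constant sequence
  shows that the limit is attained.\<close>

lemma S_lim_eqI:
  fixes A B :: "(real^'n) \<times> (real^'n) \<Rightarrow> real^'n^'n"
  assumes z: "z \<in> smooth_pts F"
    and near: "\<forall>\<^sub>F z' in nhds z. z' \<in> smooth_pts F \<longrightarrow> tg (tangent_cone (gph F) z') = rge (A z') (B z')"
    and Zn: "\<And>z'. rge (A z') (B z') \<in> Zn"
    and cont: "\<And>u. isCont (\<lambda>z. (A z *v u, B z *v u)) z"
  shows "{L \<in> Zn. \<exists>\<zeta> :: nat \<Rightarrow> (real^'n) \<times> (real^'n).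
      (\<forall>k. \<zeta> k \<in> smooth_pts F) \<and> \<zeta> \<longlonglongrightarrow> z \<and>
      (\<lambda>k. dist_Zn (tg (tangent_cone (gph F) (\<zeta> k))) L) \<longlonglongrightarrow> 0} = {rge (A z) (B z)}"
    (is "?S = _")
proof -
  have "L = rge (A z) (B z)" if L: "L \<in> Zn" and \<zeta>: "\<forall>k. \<zeta> k \<in> smooth_pts F" "\<zeta> \<longlonglongrightarrow> z"
    and lim: "(\<lambda>k. dist_Zn (tg (tangent_cone (gph F) (\<zeta> k))) L) \<longlonglongrightarrow> 0" for L \<zeta>
  proof (rule Zn_limit_unique[OF Zn L _ lim])
    have ev: "\<forall>\<^sub>F k in sequentially. tg (tangent_cone (gph F) (\<zeta> k)) = rge (A (\<zeta> k)) (B (\<zeta> k))"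
      using eventually_compose_filterlim[OF near \<zeta>(2)] \<zeta>(1) by simp
    then show "\<forall>\<^sub>F k in sequentially. tg (tangent_cone (gph F) (\<zeta> k)) \<in> Zn"
      by eventually_elim (simp add: Zn)
    fix p assume "p \<in> rge (A z) (B z)"
    then obtain u where p: "p = (A z *v u, B z *v u)"
      by (auto simp: rge_def)
    have "(\<lambda>k. (A (\<zeta> k) *v u, B (\<zeta> k) *v u)) \<longlonglongrightarrow> p"
      unfolding p by (rule isCont_tendsto_compose[OF cont \<zeta>(2)])
    moreover have "\<forall>\<^sub>F k in sequentially. (A (\<zeta> k) *v u, B (\<zeta> k) *v u) \<in> tg (tangent_cone (gph F) (\<zeta> k))"
      using ev by eventually_elim (auto simp: rge_def)
    ultimately show "\<exists>\<xi>. \<xi> \<longlonglongrightarrow> p \<and> (\<forall>\<^sub>F k in sequentially. \<xi> k \<in> tg (tangent_cone (gph F) (\<zeta> k)))"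
      by blast
  qed
  moreover have "rge (A z) (B z) \<in> ?S"
    using z eventually_nhds_x_imp_x[OF near] by (auto simp: Zn intro!: exI[of _ "\<lambda>_. z"])
  ultimately show ?thesis by blast
qed

lemma S_sets_eqI:
  fixes A B A' B' :: "(real^'n) \<times> (real^'n) \<Rightarrow> real^'n^'n"
  assumes z: "z \<in> smooth_pts F"
    and near: "\<forall>\<^sub>F z' in nhds z. z' \<in> smooth_pts F \<longrightarrow> tangent_cone (gph F) z' = rge (A z') (B z')"
    and adj: "\<And>z'. adj_subspace (rge (A z') (B z')) = rge (A' z') (B' z')"
    and Zn: "\<And>z'. rge (A z') (B z') \<in> Zn" "\<And>z'. rge (A' z') (B' z') \<in> Zn"
    and cont: "\<And>u. isCont (\<lambda>z. (A z *v u, B z *v u)) z" "\<And>u. isCont (\<lambda>z. (A' z *v u, B' z *v u)) z"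
  shows "S_hat F z = {rge (A z) (B z)}" "S_lim F z = {rge (A z) (B z)}"
    "S_hat_adj F z = {rge (A' z) (B' z)}" "S_lim_adj F z = {rge (A' z) (B' z)}"
proof -
  have tan: "tangent_cone (gph F) z = rge (A z) (B z)"
    using eventually_nhds_x_imp_x[OF near] z by simp
  show "S_hat F z = {rge (A z) (B z)}" "S_hat_adj F z = {rge (A' z) (B' z)}"
    using z by (simp_all add: S_hat_def S_hat_adj_def tan adj)
  show "S_lim F z = {rge (A z) (B z)}"
    unfolding S_lim_def using S_lim_eqI[OF z near Zn(1) cont(1)] .
  have near': "\<forall>\<^sub>F z' in nhds z. z' \<in> smooth_pts F \<longrightarrow>
      adj_subspace (tangent_cone (gph F) z') = rge (A' z') (B' z')"
    using near by eventually_elim (simp add: adj)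
  show "S_lim_adj F z = {rge (A' z) (B' z)}"
    unfolding S_lim_adj_def using S_lim_eqI[OF z near' Zn(2) cont(2)] .
qed

lemma smooth_pts_gph: "z \<in> smooth_pts F \<Longrightarrow> z \<in> gph F"
  by (simp add: smooth_pts_def)

section \<open>The set of smooth points\<close>

text \<open>Raising \<open>x $ 3\<close> with \<open>y = 0\<close> stays in the graph, but no graph
  point has negative \<open>x $ 3\<close>, so the cone contains \<open>?e\<close> without
  \<open>- ?e\<close>.\<close>

lemma tangent_cone_corner:
  assumes F: "\<F> > 0" and "x $ 3 = 0"
  shows "\<not> subspace (tangent_cone (gph (Qt \<F>)) (x, 0))"
proof
  let ?T = "tangent_cone (gph (Qt \<F>)) (x, 0)" and ?e = "(axis 3 1, 0) :: (real^3) \<times> (real^3)"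
  assume S: "subspace ?T"
  have "?e \<in> ?T"
  proof (rule tangent_coneI_curve)
    show "((\<lambda>t. (x + t *\<^sub>R axis 3 1, 0 :: real^3)) has_vector_derivative ?e) (at 0)"
      by (auto intro!: derivative_eq_intros)
    show "\<forall>\<^sub>F t in at_right 0. (x + t *\<^sub>R axis 3 1, 0) \<in> gph (Qt \<F>)"
      using eventually_at_right_less[of 0]
      by eventually_elim (use gph_Qt_zero[OF F] assms in \<open>auto simp: axis_def\<close>)
  qed simp
  then have "- ?e \<in> ?T"
    using S by (rule subspace_neg[rotated])
  then obtain t w where t: "\<And>k. 0 < t k" and w: "w \<longlonglongrightarrow> - ?e"
    and gph: "\<And>k. (x, 0) + t k *\<^sub>R w k \<in> gph (Qt \<F>)"
    by (auto simp: tangent_cone_def)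
  have "(\<lambda>k. fst (w k) $ 3) \<longlonglongrightarrow> fst (- ?e) $ 3"
    by (intro tendsto_intros w)
  moreover have "fst (w k) $ 3 \<ge> 0" for k
  proof -
    have "(x + t k *\<^sub>R fst (w k), t k *\<^sub>R snd (w k)) \<in> gph (Qt \<F>)"
      using gph[of k] by (cases "w k") simp
    then have "t k * fst (w k) $ 3 \<ge> 0"
      using assms by (simp add: gph_Qt_iff)
    then show ?thesis
      using t[of k] by (simp add: zero_le_mult_iff)
  qed
  ultimately have "fst (- ?e) $ 3 \<ge> 0"
    by (intro tendsto_lowerbound) auto
  then show False by (simp add: axis_def)
qed

text \<open>Slip may start in the direction of \<open>v12 y\<close>. Starting in the opposite
  direction would force, in the limit, the squared norm of \<open>v12 y\<close> to equal its own
  negative.\<close>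

lemma tangent_cone_cone_boundary:
  assumes F: "\<F> > 0" and y: "y $ 3 < 0" "norm (v12 y) = - \<F> * y $ 3"
  shows "\<not> subspace (tangent_cone (gph (Qt \<F>)) (0, y))"
proof
  let ?T = "tangent_cone (gph (Qt \<F>)) (0, y)" and ?e = "(vec21 (v12 y) 0, 0) :: (real^3) \<times> (real^3)"
  assume S: "subspace ?T"
  have pos: "norm (v12 y) > 0"
    using F y by (simp add: mult_pos_neg)
  have "?e \<in> ?T"
  proof (rule tangent_coneI_curve)
    show "((\<lambda>t. (t *\<^sub>R vec21 (v12 y) 0, y)) has_vector_derivative ?e) (at 0)"
      by (auto intro!: derivative_eq_intros)
    show "\<forall>\<^sub>F t in at_right 0. (t *\<^sub>R vec21 (v12 y) 0, y) \<in> gph (Qt \<F>)"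
      using eventually_at_right_less[of 0]
      by eventually_elim
        (use gph_Qt_nonpos[OF F y(1)] y(2) in \<open>simp add: y(2)[symmetric] dot_square_norm power2_eq_square\<close>)
  qed simp
  then have "- ?e \<in> ?T"
    using S by (rule subspace_neg[rotated])
  then obtain t w where t: "\<And>k. 0 < t k" "t \<longlonglongrightarrow> 0" and w: "w \<longlonglongrightarrow> - ?e"
    and gph: "\<And>k. (0, y) + t k *\<^sub>R w k \<in> gph (Qt \<F>)"
    by (auto simp: tangent_cone_def)
  define Y where "Y k = y + t k *\<^sub>R snd (w k)" for k
  have Y: "Y \<longlonglongrightarrow> y"
    using tendsto_add[OF tendsto_const[of y] tendsto_scaleR[OF t(2) tendsto_snd[OF w]]]
    by (simp add: Y_def[abs_def])
  \<comment> \<open>The slip law is positively homogeneous in \<open>x\<close>, so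
    \<open>t k\<close> cancels and the equation survives for the directions themselves.\<close>
  have "v12 (Y k) \<bullet> v12 (fst (w k)) = - \<F> * Y k $ 3 * norm (v12 (fst (w k)))" for k
  proof -
    have "(t k *\<^sub>R fst (w k), Y k) \<in> gph (Qt \<F>)"
      using gph[of k] by (cases "w k") (simp add: Y_def)
    then have "t k * (v12 (Y k) \<bullet> v12 (fst (w k))) = t k * (- \<F> * Y k $ 3 * norm (v12 (fst (w k))))"
      using F t(1)[of k] by (simp add: gph_Qt_iff)
    then show ?thesis
      using t(1)[of k] by (metis mult_left_cancel less_irrefl)
  qed
  then have "(\<lambda>k. - \<F> * Y k $ 3 * norm (v12 (fst (w k)))) \<longlonglongrightarrow> v12 y \<bullet> v12 (fst (- ?e))"
    using tendsto_inner[OF tendsto_v12[OF Y] tendsto_v12[OF tendsto_fst[OF w]]] by (simp only:)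
  moreover have "(\<lambda>k. - \<F> * Y k $ 3 * norm (v12 (fst (w k)))) \<longlonglongrightarrow> - \<F> * y $ 3 * norm (v12 (fst (- ?e)))"
    by (intro tendsto_intros Y w)
  ultimately have "v12 y \<bullet> v12 (fst (- ?e)) = - \<F> * y $ 3 * norm (v12 (fst (- ?e)))"
    by (rule LIMSEQ_unique)
  then show False
    using pos unfolding y(2)[symmetric] by (simp add: dot_square_norm power2_eq_square)
qed

lemma smooth_pts_Qt:
  assumes F: "\<F> > 0"
  shows "smooth_pts (Qt \<F>) = set_L \<F> \<union> set_M1 \<F> \<union> set_M3p \<F>"
proof (intro set_eqI; clarify)
  fix x y :: "real^3"
  have "(x, y) \<in> smooth_pts (Qt \<F>)" if "(x, y) \<in> set_L \<F>"
    using that tangent_cone_L[OF F] by (simp add: set_L_iff smooth_pts_def rge_mat_0_Zn)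
  moreover have "(x, y) \<in> smooth_pts (Qt \<F>)" if "(x, y) \<in> set_M1 \<F>"
    using that tangent_cone_M1[OF F] by (simp add: set_M1_iff smooth_pts_def slip_tangent_Zn)
  moreover have "(x, y) \<in> smooth_pts (Qt \<F>)" if "(x, y) \<in> set_M3p \<F>"
    using that tangent_cone_M3p[OF F] gph_Qt_stick[OF F]
    by (auto simp: set_M3p_iff smooth_pts_def rge_0_mat_Zn)
  moreover have "(x, y) \<in> set_L \<F> \<union> set_M1 \<F> \<union> set_M3p \<F>" if s: "(x, y) \<in> smooth_pts (Qt \<F>)"
  proof (rule ccontr)
    assume *: "(x, y) \<notin> set_L \<F> \<union> set_M1 \<F> \<union> set_M3p \<F>"
    have g: "(x, y) \<in> gph (Qt \<F>)" and sub: "subspace (tangent_cone (gph (Qt \<F>)) (x, y))"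
      using s by (auto simp: smooth_pts_def Zn_def)
    show False
    proof (cases "y $ 3 = 0")
      case True
      then have "y = 0" "x $ 3 = 0"
        using * g gph_Qt_zero[OF F True, of x] by (auto simp: set_L_iff)
      then show False
        using sub tangent_cone_corner[OF F] by blast
    next
      case False
      then have y: "y $ 3 < 0"
        using g F by (auto simp: gph_Qt_iff)
      then have "x $ 3 = 0" "v12 x = 0" "norm (v12 y) = - \<F> * y $ 3"
        using * g gph_Qt_nonpos[OF F y, of x] by (auto simp: set_M1_iff set_M3p_iff)
      moreover from this have "x = 0"
        by (simp add: vec3_eq_iff)
      ultimately show False
        using sub tangent_cone_cone_boundary[OF F y] by blast
    qed
  qed
  ultimately show "(x, y) \<in> smooth_pts (Qt \<F>) \<longleftrightarrow> (x, y) \<in> set_L \<F> \<union> set_M1 \<F> \<union> set_M3p \<F>"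
    by blast
qed

section \<open>The SCD derivatives at smooth points\<close>

lemma S_sets_L:
  assumes F: "\<F> > 0" and z: "(x, y) \<in> set_L \<F>"
  shows "S_hat (Qt \<F>) (x, y) = {rge (mat 1) 0}" "S_lim (Qt \<F>) (x, y) = {rge (mat 1) 0}"
    "S_hat_adj (Qt \<F>) (x, y) = {rge (mat 1) 0}" "S_lim_adj (Qt \<F>) (x, y) = {rge (mat 1) 0}"
proof -
  have s: "(x, y) \<in> smooth_pts (Qt \<F>)"
    using z smooth_pts_Qt[OF F] by blast
  have "\<forall>\<^sub>F z in nhds (x, y). fst z $ 3 > 0"
    by (rule order_tendstoD(1)[of _ "x $ 3"], intro tendsto_intros nhds_tendsto_pair)
      (use z in \<open>simp add: set_L_iff\<close>)
  then have near: "\<forall>\<^sub>F z in nhds (x, y). z \<in> smooth_pts (Qt \<F>) \<longrightarrow>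
      tangent_cone (gph (Qt \<F>)) z = rge (mat 1) 0"
    by eventually_elim (use tangent_cone_L[OF F] smooth_pts_gph in force)
  show "S_hat (Qt \<F>) (x, y) = {rge (mat 1) 0}" "S_lim (Qt \<F>) (x, y) = {rge (mat 1) 0}"
    "S_hat_adj (Qt \<F>) (x, y) = {rge (mat 1) 0}" "S_lim_adj (Qt \<F>) (x, y) = {rge (mat 1) 0}"
    by (rule S_sets_eqI[OF s near adj_rge_mat_0 rge_mat_0_Zn rge_mat_0_Zn]; simp)+
qed

lemma S_sets_M3p:
  assumes F: "\<F> > 0" and z: "(x, y) \<in> set_M3p \<F>"
  shows "S_hat (Qt \<F>) (x, y) = {rge 0 (mat 1)}" "S_lim (Qt \<F>) (x, y) = {rge 0 (mat 1)}"
    "S_hat_adj (Qt \<F>) (x, y) = {rge 0 (mat 1)}" "S_lim_adj (Qt \<F>) (x, y) = {rge 0 (mat 1)}"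
proof -
  have s: "(x, y) \<in> smooth_pts (Qt \<F>)"
    using z smooth_pts_Qt[OF F] by blast
  have "\<forall>\<^sub>F z in nhds (x, y). snd z $ 3 < 0 \<and> norm (v12 (snd z)) < - \<F> * snd z $ 3"
    using nhds_M3p[OF F, of y x] z by (simp add: set_M3p_iff)
  then have near: "\<forall>\<^sub>F z in nhds (x, y). z \<in> smooth_pts (Qt \<F>) \<longrightarrow>
      tangent_cone (gph (Qt \<F>)) z = rge 0 (mat 1)"
  proof eventually_elim
    case (elim z)
    then show ?case
      using gph_Qt_stick[OF F, of "snd z" "fst z"] tangent_cone_M3p[OF F, of "snd z"] smooth_pts_gph[of z]
      by (cases z) auto
  qed
  show "S_hat (Qt \<F>) (x, y) = {rge 0 (mat 1)}" "S_lim (Qt \<F>) (x, y) = {rge 0 (mat 1)}"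
    "S_hat_adj (Qt \<F>) (x, y) = {rge 0 (mat 1)}" "S_lim_adj (Qt \<F>) (x, y) = {rge 0 (mat 1)}"
    by (rule S_sets_eqI[OF s near adj_rge_0_mat rge_0_mat_Zn rge_0_mat_Zn]; simp)+
qed

lemma S_sets_M1:
  assumes F: "\<F> > 0" and z: "(x, y) \<in> set_M1 \<F>"
  shows "S_hat (Qt \<F>) (x, y) = {slip_tangent \<F> (y $ 3) (v12 x)}"
    "S_lim (Qt \<F>) (x, y) = {slip_tangent \<F> (y $ 3) (v12 x)}"
    "S_hat_adj (Qt \<F>) (x, y) = {slip_adjoint \<F> (y $ 3) (v12 x)}"
    "S_lim_adj (Qt \<F>) (x, y) = {slip_adjoint \<F> (y $ 3) (v12 x)}"
proof -
  let ?C = "\<lambda>z. slip_curv \<F> (snd z $ 3) (v12 (fst z))"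
  \<comment> \<open>The matrices are functions of the base point. With division by zero yielding 0,
    they give elements of \<open>Zn\<close> and adjoint pairs at every point, as
    \<open>S_sets_eqI\<close> asks; \<open>v12 x \<noteq> 0\<close> enters through
    continuity.\<close>
  let ?A = "\<lambda>z. block (mat 1) 0 0 0"
    and ?B = "\<lambda>z. block (?C z) ((- \<F> / norm (v12 (fst z))) *\<^sub>R v12 (fst z)) 0 1"
    and ?A' = "\<lambda>z. block (mat 1) 0 ((\<F> / norm (v12 (fst z))) *\<^sub>R v12 (fst z)) 0"
    and ?B' = "\<lambda>z. block (?C z) 0 0 1"
  have s: "(x, y) \<in> smooth_pts (Qt \<F>)"
    using z smooth_pts_Qt[OF F] by blast
  have x: "v12 x \<noteq> 0"
    using z by (simp add: set_M1_iff)
  have "\<forall>\<^sub>F z in nhds (x, y). snd z $ 3 < 0 \<and> v12 (fst z) \<noteq> 0"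
    using nhds_M1 z by (simp add: set_M1_iff)
  then have near: "\<forall>\<^sub>F z in nhds (x, y). z \<in> smooth_pts (Qt \<F>) \<longrightarrow>
      tangent_cone (gph (Qt \<F>)) z = rge (?A z) (?B z)"
  proof eventually_elim
    case (elim z)
    then show ?case
      using tangent_cone_M1[OF F, of "fst z" "snd z"] smooth_pts_gph[of z "Qt \<F>"]
      by (cases z) (auto simp: slip_tangent_def)
  qed
  note Zn = slip_tangent_Zn[unfolded slip_tangent_def] slip_adjoint_Zn[unfolded slip_adjoint_def]
    and adj = adj_slip_tangent[unfolded slip_tangent_def slip_adjoint_def]
  have cont: "isCont (\<lambda>z. (?A z *v u, ?B z *v u)) (x, y)" "isCont (\<lambda>z. (?A' z *v u, ?B' z *v u)) (x, y)" for u
    unfolding block_mult slip_curv_mult isCont_def using x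
    by (auto intro!: tendsto_eq_intros)
  note S = S_sets_eqI[where A = ?A and B = ?B and A' = ?A' and B' = ?B', OF s near adj Zn cont]
  show "S_hat (Qt \<F>) (x, y) = {slip_tangent \<F> (y $ 3) (v12 x)}"
    "S_lim (Qt \<F>) (x, y) = {slip_tangent \<F> (y $ 3) (v12 x)}"
    "S_hat_adj (Qt \<F>) (x, y) = {slip_adjoint \<F> (y $ 3) (v12 x)}"
    "S_lim_adj (Qt \<F>) (x, y) = {slip_adjoint \<F> (y $ 3) (v12 x)}"
    using S by (simp_all only: slip_tangent_def slip_adjoint_def fst_conv snd_conv)
qed

section \<open>The SCD property\<close>

text \<open>Along a sequence with constant tangent space the distances to the limit are all
  zero.\<close>

lemma S_lim_adj_nonemptyI:
  assumes "L \<in> Zn" "\<zeta> \<longlonglongrightarrow> z" "\<And>k. \<zeta> k \<in> gph F" "\<And>k. tangent_cone (gph F) (\<zeta> k) = T"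
    "T \<in> Zn" "adj_subspace T = L"
  shows "S_lim_adj F z \<noteq> {}"
proof -
  have "L \<in> S_lim_adj F z"
    unfolding S_lim_adj_def
    by (intro CollectI conjI exI[of _ \<zeta>] allI) (simp_all add: assms smooth_pts_def)
  then show ?thesis by blast
qed

lemma SCD_mapping_Qt:
  assumes F: "\<F> > 0"
  shows "SCD_mapping (Qt \<F>)"
  unfolding SCD_mapping_def
proof clarify
  fix x y assume g: "(x, y) \<in> gph (Qt \<F>)" and empty: "S_lim_adj (Qt \<F>) (x, y) = {}"
  define \<epsilon> where "\<epsilon> k = inverse (real (Suc k))" for k
  have \<epsilon>: "\<epsilon> \<longlonglongrightarrow> 0" "0 < \<epsilon> k" "\<epsilon> k \<le> 1" for k
    using LIMSEQ_inverse_real_of_nat by (simp_all add: \<epsilon>_def[abs_def] inverse_le_1_iff)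
  have *: "(x, y) \<notin> set_L \<F>" "(x, y) \<notin> set_M1 \<F>" "(x, y) \<notin> set_M3p \<F>"
    using S_sets_L(4)[OF F, of x y] S_sets_M1(4)[OF F, of x y] S_sets_M3p(4)[OF F, of x y]
    unfolding empty by auto
  have "S_lim_adj (Qt \<F>) (x, y) \<noteq> {}"
  proof (cases "y $ 3 = 0")
    case True
    then have y: "y = 0" and x: "x $ 3 \<ge> 0"
      using g gph_Qt_zero[OF F True, of x] by auto
    \<comment> \<open>Lifting \<open>x $ 3\<close> by \<open>\<epsilon> k\<close> moves the point
      into \<open>set_L\<close>.\<close>
    let ?\<zeta> = "\<lambda>k. (x + \<epsilon> k *\<^sub>R axis 3 1, 0) :: (real^3) \<times> (real^3)"
    have pos: "fst (?\<zeta> k) $ 3 > 0" for k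
      using x \<epsilon>(2)[of k] by (simp add: axis_def)
    show ?thesis
    proof (rule S_lim_adj_nonemptyI[OF rge_mat_0_Zn _ _ _ rge_mat_0_Zn adj_rge_mat_0])
      show "?\<zeta> \<longlonglongrightarrow> (x, y)"
        using y by (auto intro!: tendsto_eq_intros \<epsilon>(1))
      show "?\<zeta> k \<in> gph (Qt \<F>)" for k
        using gph_Qt_pos[OF F] pos[of k] by simp
      then show "tangent_cone (gph (Qt \<F>)) (?\<zeta> k) = rge (mat 1) 0" for k
        using tangent_cone_L[OF F] pos[of k] by simp
    qed
  next
    case False
    then have y: "y $ 3 < 0"
      using g F by (auto simp: gph_Qt_iff)
    then have "x $ 3 = 0" "v12 x = 0" and n: "norm (v12 y) = - \<F> * y $ 3"
      using * g gph_Qt_nonpos[OF F y, of x] by (auto simp: set_M1_iff set_M3p_iff)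
    then have x: "x = 0"
      by (simp add: vec3_eq_iff)
    \<comment> \<open>Shrinking \<open>v12 y\<close> at fixed \<open>y $ 3\<close> moves the point
      into \<open>set_M3p\<close>; since \<open>\<epsilon> k \<le> 1\<close>, the factor is
      nonnegative and the norm strictly drops.\<close>
    let ?Y = "\<lambda>k. vec21 ((1 - \<epsilon> k) *\<^sub>R v12 y) (y $ 3)"
    have pos: "?Y k $ 3 < 0" "norm (v12 (?Y k)) < - \<F> * ?Y k $ 3" for k
    proof -
      have "norm (v12 y) > 0"
        using n F y by (simp add: mult_pos_neg)
      then have "norm (v12 (?Y k)) < norm (v12 y)"
        using \<epsilon>(2,3)[of k] by simp
      then show "norm (v12 (?Y k)) < - \<F> * ?Y k $ 3" "?Y k $ 3 < 0"
        using n y by auto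
    qed
    show ?thesis
    proof (rule S_lim_adj_nonemptyI[OF rge_0_mat_Zn _ _ _ rge_0_mat_Zn adj_rge_0_mat])
      have "(\<lambda>k. (0 :: real^3, ?Y k)) \<longlonglongrightarrow> (0, vec21 ((1 - 0) *\<^sub>R v12 y) (y $ 3))"
        by (intro tendsto_intros \<epsilon>(1))
      then show "(\<lambda>k. (0, ?Y k)) \<longlonglongrightarrow> (x, y)"
        by (simp add: x)
      show "(0, ?Y k) \<in> gph (Qt \<F>)" for k
        using gph_Qt_stick[OF F pos] by blast
      show "tangent_cone (gph (Qt \<F>)) (0, ?Y k) = rge 0 (mat 1)" for k
        by (rule tangent_cone_M3p[OF F pos])
    qed
  qed
  with empty show False by blast
qed

theorem proposition6p6:
  fixes \<F> :: real
  assumes "\<F> > 0"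
  shows "SCD_mapping (Qt \<F>) \<and>
    smooth_pts (Qt \<F>) = set_L \<F> \<union> set_M1 \<F> \<union> set_M3p \<F> \<and>
    (\<forall>(v :: real^3) (g :: real^2) (\<theta> :: real). (v, vec21 g \<theta>) \<in> set_L \<F> \<longrightarrow>
        S_hat (Qt \<F>) (v, vec21 g \<theta>) = {rge (mat 1) 0} \<and>
        S_lim (Qt \<F>) (v, vec21 g \<theta>) = {rge (mat 1) 0} \<and>
        S_hat_adj (Qt \<F>) (v, vec21 g \<theta>) = {rge (mat 1) 0} \<and>
        S_lim_adj (Qt \<F>) (v, vec21 g \<theta>) = {rge (mat 1) 0}) \<and>
    (\<forall>(v :: real^3) (g :: real^2) (\<theta> :: real). (v, vec21 g \<theta>) \<in> set_M3p \<F> \<longrightarrow>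
        S_hat (Qt \<F>) (v, vec21 g \<theta>) = {rge 0 (mat 1)} \<and>
        S_lim (Qt \<F>) (v, vec21 g \<theta>) = {rge 0 (mat 1)} \<and>
        S_hat_adj (Qt \<F>) (v, vec21 g \<theta>) = {rge 0 (mat 1)} \<and>
        S_lim_adj (Qt \<F>) (v, vec21 g \<theta>) = {rge 0 (mat 1)}) \<and>
    (\<forall>(v :: real^3) (g :: real^2) (\<theta> :: real). (v, vec21 g \<theta>) \<in> set_M1 \<F> \<longrightarrow>
      (let w = v12 v;
           B = (- \<F> * \<theta> * (1 / norm w)) *\<^sub>R (mat 1 - (1 / (norm w)\<^sup>2) *\<^sub>R outer w);
           T = rge (block (mat 1) 0 0 0)
                   (block B ((- \<F> / norm w) *\<^sub>R w) 0 1);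
           Tadj = rge (block (mat 1) 0 ((\<F> / norm w) *\<^sub>R w) 0)
                      (block B 0 0 1)
       in S_hat (Qt \<F>) (v, vec21 g \<theta>) = {T} \<and>
          S_lim (Qt \<F>) (v, vec21 g \<theta>) = {T} \<and>
          S_hat_adj (Qt \<F>) (v, vec21 g \<theta>) = {Tadj} \<and>
          S_lim_adj (Qt \<F>) (v, vec21 g \<theta>) = {Tadj}))"
proof (intro conjI allI impI)
  show "SCD_mapping (Qt \<F>)" "smooth_pts (Qt \<F>) = set_L \<F> \<union> set_M1 \<F> \<union> set_M3p \<F>"
    using SCD_mapping_Qt smooth_pts_Qt assms by auto
next
  fix v g \<theta> assume z: "(v, vec21 g \<theta>) \<in> set_M1 \<F>"
  show "let w = v12 v;
           B = (- \<F> * \<theta> * (1 / norm w)) *\<^sub>R (mat 1 - (1 / (norm w)\<^sup>2) *\<^sub>R outer w);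
           T = rge (block (mat 1) 0 0 0)
                   (block B ((- \<F> / norm w) *\<^sub>R w) 0 1);
           Tadj = rge (block (mat 1) 0 ((\<F> / norm w) *\<^sub>R w) 0)
                      (block B 0 0 1)
       in S_hat (Qt \<F>) (v, vec21 g \<theta>) = {T} \<and>
          S_lim (Qt \<F>) (v, vec21 g \<theta>) = {T} \<and>
          S_hat_adj (Qt \<F>) (v, vec21 g \<theta>) = {Tadj} \<and>
          S_lim_adj (Qt \<F>) (v, vec21 g \<theta>) = {Tadj}"
    unfolding Let_def S_sets_M1[OF assms z] slip_tangent_def slip_adjoint_def slip_curv_def vec21_nth
    by (intro conjI refl)
qed (simp_all only: S_sets_L[OF assms] S_sets_M3p[OF assms])

end
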